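(* For the stochastic minimum problem described in the context with arbitrary query costs, the deterministic algorithm that computes the expected costs $A_1=\sum_{i=1}^n w_i\prod_{j<i}\Pr[v_j>\ell_i]$ of strategy (i) and $A_R=\sum_{i>1}w_i+w_1\big(1-\prod_{i>1}\Pr[v_i>r_1]\big)$ of strategy (ii) and runs the strategy with the smaller value has expected query cost at most $\tfrac32\,\mathrm{opt}^*$, where $\mathrm{opt}^*$ is the minimum expected query cost of any adaptive strategy.
   Context: There are $n\ge 2$ unknown reals $v_1,\dots,v_n$ with open intervals $I_i=(\ell_i,r_i)\ni v_i$ and query costs $w_i>0$; querying $I_i$ costs $w_i$ and reveals $v_i$; the goal is to identify an index attaining $\min_j v_j$. The $v_i$ are independent random variables with known distributions on $I_i$, with positive probability arbitrarily close to each endpoint of $I_i$. Standing assumptions: $\ell_1\le\dots\le\ell_n$, every two intervals intersect, and $I_1$ contains no other interval. Strategy (i) ("query $I_1$ and cascade"): query $I_1$, then for $i=2,\dots,n$ in order query $I_i$ iff every value revealed so far exceeds $\ell_i$. Strategy (ii): query $I_2,\dots,I_n$, then query $I_1$ iff some revealed $v_i$ ($i\ge2$) is less than $r_1$.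
   Formalization: If some v_i (i>1) has an atom at r_1, the displayed A_R is not the expected cost of strategy (ii) and the 3/2 bound can fail; so the bound is stated with the true expected cost of (ii) for all distributions, and with the displayed A_R when no v_i (i>1) has an atom at r_1. *)

theory Defs
  imports "HOL-Probability.Probability"
begin

text \<open>An adaptive strategy is a decision tree. \<open>Stop k\<close> declares \<open>k\<close> to be an index of a minimum
  value; \<open>Query i f\<close> queries \<open>I\<^sub>i\<close> and proceeds with \<open>f y\<close> if the revealed value is \<open>y\<close>. Below,
  \<open>x :: nat \<Rightarrow> real\<close> is a realization of the values.\<close>

datatype strategy = Stop nat | Query nat "real \<Rightarrow> strategy"

primrec outcome :: "strategy \<Rightarrow> (nat \<Rightarrow> real) \<Rightarrow> nat" where
  "outcome (Stop k) x = k"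
| "outcome (Query i f) x = outcome (f (x i)) x"

primrec queried :: "strategy \<Rightarrow> (nat \<Rightarrow> real) \<Rightarrow> nat set" where
  "queried (Stop k) x = {}"
| "queried (Query i f) x = insert i (queried (f (x i)) x)"

primrec cost :: "(nat \<Rightarrow> real) \<Rightarrow> strategy \<Rightarrow> (nat \<Rightarrow> real) \<Rightarrow> real" where
  "cost w (Stop k) x = 0"
| "cost w (Query i f) x = w i + cost w (f (x i)) x"

text \<open>\<open>admissible \<sigma> S\<close>: only intervals with index in \<open>S\<close> are queried, each at most once.\<close>

primrec admissible :: "strategy \<Rightarrow> nat set \<Rightarrow> bool" where
  "admissible (Stop k) S \<longleftrightarrow> True"
| "admissible (Query i f) S \<longleftrightarrow> i \<in> S \<and> (\<forall>y. admissible (f y) (S - {i}))"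

text \<open>Without this condition expected costs would not make sense for all decision trees.\<close>

definition measurable_strategy :: "nat \<Rightarrow> strategy \<Rightarrow> bool" where
  "measurable_strategy n \<sigma> \<longleftrightarrow>
     (\<forall>i. Measurable.pred (Pi\<^sub>M {1..n} (\<lambda>_. borel)) (\<lambda>x. i \<in> queried \<sigma> x)) \<and>
     outcome \<sigma> \<in> measurable (Pi\<^sub>M {1..n} (\<lambda>_. borel)) (count_space UNIV)"

definition solves_minimum :: "'a measure \<Rightarrow> (nat \<Rightarrow> 'a \<Rightarrow> real) \<Rightarrow> nat \<Rightarrow> strategy \<Rightarrow> bool" where
  "solves_minimum M v n \<sigma> \<longleftrightarrow>
     admissible \<sigma> {1..n} \<and> measurable_strategy n \<sigma> \<and>
     (AE \<omega> in M. is_arg_min (\<lambda>i. v i \<omega>) (\<lambda>i. i \<in> {1..n}) (outcome \<sigma> (\<lambda>i. v i \<omega>)))"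

definition expected_cost ::
  "'a measure \<Rightarrow> (nat \<Rightarrow> 'a \<Rightarrow> real) \<Rightarrow> (nat \<Rightarrow> real) \<Rightarrow> strategy \<Rightarrow> real" where
  "expected_cost M v w \<sigma> = (\<integral>\<omega>. cost w \<sigma> (\<lambda>i. v i \<omega>) \<partial>M)"

definition opt_cost ::
  "'a measure \<Rightarrow> (nat \<Rightarrow> 'a \<Rightarrow> real) \<Rightarrow> nat \<Rightarrow> (nat \<Rightarrow> real) \<Rightarrow> real" where
  "opt_cost M v n w = (INF \<sigma> \<in> {\<sigma>. solves_minimum M v n \<sigma>}. expected_cost M v w \<sigma>)"

text \<open>The strategies (i) and (ii). A history \<open>h\<close> lists the pairs of a queried index and the value
  revealed for it; in the end an index of least revealed value is returned, except that (ii)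
  returns \<open>1\<close> if it leaves \<open>I\<^sub>1\<close> unqueried.\<close>

definition best :: "(nat \<times> real) list \<Rightarrow> nat" where
  "best h = fst (arg_min_list snd h)"

primrec cascade :: "(nat \<Rightarrow> real) \<Rightarrow> nat list \<Rightarrow> (nat \<times> real) list \<Rightarrow> strategy" where
  "cascade l [] h = Stop (best h)"
| "cascade l (i # is) h =
     (if \<forall>(j, y) \<in> set h. l i < y then Query i (\<lambda>y. cascade l is ((i, y) # h))
      else cascade l is h)"

definition strategy_i :: "nat \<Rightarrow> (nat \<Rightarrow> real) \<Rightarrow> strategy" where
  "strategy_i n l = Query 1 (\<lambda>y. cascade l [2..<Suc n] [(1, y)])"

primrec query_all ::
  "nat list \<Rightarrow> ((nat \<times> real) list \<Rightarrow> strategy) \<Rightarrow> (nat \<times> real) list \<Rightarrow> strategy" where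
  "query_all [] \<kappa> h = \<kappa> h"
| "query_all (i # is) \<kappa> h = Query i (\<lambda>y. query_all is \<kappa> ((i, y) # h))"

definition strategy_ii :: "nat \<Rightarrow> (nat \<Rightarrow> real) \<Rightarrow> strategy" where
  "strategy_ii n r =
     query_all [2..<Suc n]
       (\<lambda>h. if \<exists>(i, y) \<in> set h. y < r 1 then Query 1 (\<lambda>y. Stop (best ((1, y) # h))) else Stop 1) []"

definition A_1 ::
  "'a measure \<Rightarrow> (nat \<Rightarrow> 'a \<Rightarrow> real) \<Rightarrow> nat \<Rightarrow> (nat \<Rightarrow> real) \<Rightarrow> (nat \<Rightarrow> real) \<Rightarrow> real" where
  "A_1 M v n l w = (\<Sum>i=1..n. w i * (\<Prod>j\<in>{1..<i}. \<P>(\<omega> in M. v j \<omega> > l i)))"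

text \<open>Strategy (ii) leaves \<open>I\<^sub>1\<close> unqueried iff \<open>v\<^sub>i \<ge> r\<^sub>1\<close> for all \<open>i > 1\<close>, so \<open>A_R\<close> is its expected cost if
  no \<open>v\<^sub>i\<close> with \<open>i > 1\<close> has an atom at \<open>r\<^sub>1\<close>, but may exceed it otherwise.\<close>

definition A_R ::
  "'a measure \<Rightarrow> (nat \<Rightarrow> 'a \<Rightarrow> real) \<Rightarrow> nat \<Rightarrow> (nat \<Rightarrow> real) \<Rightarrow> (nat \<Rightarrow> real) \<Rightarrow> real" where
  "A_R M v n r w = (\<Sum>i=2..n. w i) + w 1 * (1 - (\<Prod>i=2..n. \<P>(\<omega> in M. v i \<omega> > r 1)))"

text \<open>The strategy that is run when \<open>a\<close> and \<open>b\<close> are the values computed for (i) and (ii).\<close>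

definition cheaper_strategy ::
  "nat \<Rightarrow> (nat \<Rightarrow> real) \<Rightarrow> (nat \<Rightarrow> real) \<Rightarrow> real \<Rightarrow> real \<Rightarrow> strategy" where
  "cheaper_strategy n l r a b = (if a \<le> b then strategy_i n l else strategy_ii n r)"

end

theory Submission
  imports Defs
begin

text \<open>
  Call \<open>I\<^sub>i\<close> with \<open>i \<ge> 2\<close> mandatory if \<open>v\<^sub>j > \<ell>\<^sub>i\<close> for all \<open>j < i\<close>. Resampling the unqueried values shows that
  every correct strategy queries the mandatory intervals, and that it can skip \<open>I\<^sub>1\<close> only if it
  queries all the others and all their values are at least \<open>r\<^sub>1\<close>. Strategy (i) queries exactly \<open>I\<^sub>1\<close> and
  the mandatory intervals.

  Let \<open>b\<close> be the probability that an optimal strategy skips \<open>I\<^sub>1\<close>, let \<open>p \<ge> b\<close> be the probability that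
  \<open>v\<^sub>i \<ge> r\<^sub>1\<close> for all \<open>i \<ge> 2\<close>, and put \<open>W = \<Sum>\<^sub>i\<^sub>\<ge>\<^sub>2 w\<^sub>i\<close> and \<open>S = \<Sum>\<^sub>i\<^sub>\<ge>\<^sub>2 w\<^sub>i Pr[v\<^sub>1 \<le> \<ell>\<^sub>i]\<close>. Whether \<open>I\<^sub>1\<close> is skipped does not
  depend on \<open>v\<^sub>1\<close>, hence \<open>opt \<ge> A\<^sub>1 - b (w\<^sub>1 - S)\<close>. If \<open>S \<ge> w\<^sub>1\<close>, then (i) is optimal. Otherwise
  \<open>opt \<ge> L + m\<close> with \<open>L = (1 - p) w\<^sub>1 + p W\<close> and some \<open>m \<ge> 0\<close>, while (i) costs at most \<open>L + m + p w\<^sub>1\<close>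
  and (ii) costs \<open>L + (1 - p) W\<close>; one of the two excesses is at most \<open>L / 2\<close> because \<open>(2 p - 1)\<^sup>2 \<ge> 0\<close>.
\<close>

section \<open>Runs of decision trees: queried sets, outcomes and costs\<close>

text \<open>A tree branches only on revealed values, so changing the others leaves the whole run
  unchanged. Resampling and the independence argument for interval 1 both rest on this.\<close>

lemma agree_on_queried:
  assumes "\<And>i. i \<in> queried \<sigma> x \<Longrightarrow> x i = y i"
  shows "queried \<sigma> y = queried \<sigma> x \<and> outcome \<sigma> y = outcome \<sigma> x"
  using assms
proof (induction \<sigma>)
  case (Query i f)
  have eq: "x i = y i" using Query.prems by simp
  have "queried (f (x i)) y = queried (f (x i)) x \<and> outcome (f (x i)) y = outcome (f (x i)) x"
    by (rule Query.IH[OF rangeI]) (rule Query.prems, simp)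
  then show ?case by (simp add: eq[symmetric])
qed simp

lemma queried_subset: "admissible \<sigma> S \<Longrightarrow> queried \<sigma> x \<subseteq> S"
proof (induction \<sigma> arbitrary: S)
  case (Query i f)
  have "queried (f (x i)) x \<subseteq> S - {i}" by (rule Query.IH) (use Query.prems in auto)
  then show ?case using Query.prems by auto
qed simp

text \<open>Admissibility forbids repeated queries, so no cost is counted twice. Expected costs
  thereby reduce to query probabilities.\<close>

lemma cost_eq_sum_queried:
  "admissible \<sigma> S \<Longrightarrow> finite S \<Longrightarrow> cost w \<sigma> x = sum w (queried \<sigma> x)"
proof (induction \<sigma> arbitrary: S)
  case (Query i f)
  have adm: "admissible (f (x i)) (S - {i})" using Query.prems by simp
  have "cost w (f (x i)) x = sum w (queried (f (x i)) x)"
    by (rule Query.IH[OF _ adm]) (use Query.prems in auto)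
  moreover have "i \<notin> queried (f (x i)) x" "finite (queried (f (x i)) x)"
    using queried_subset[OF adm, of x] Query.prems(2) by (auto intro: finite_subset)
  ultimately show ?case by simp
qed simp

text \<open>\<open>measurable_strategy\<close> lives on a product space, whose points are
  extensional functions, while strategies run on the unrestricted
  \<open>\<lambda>i. v i \<omega>\<close>. This passes between the two.\<close>

lemma restrict_outcome_queried:
  assumes "admissible \<sigma> S"
  shows "queried \<sigma> (restrict x S) = queried \<sigma> x" "outcome \<sigma> (restrict x S) = outcome \<sigma> x"
proof -
  have "queried \<sigma> (restrict x S) = queried \<sigma> x \<and> outcome \<sigma> (restrict x S) = outcome \<sigma> x"
    by (rule agree_on_queried) (use queried_subset[OF assms, of x] in auto)
  then show "queried \<sigma> (restrict x S) = queried \<sigma> x" "outcome \<sigma> (restrict x S) = outcome \<sigma> x"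
    by auto
qed

section \<open>Selecting an index of least revealed value\<close>

text \<open>Histories in a run on \<open>x\<close> have the form on the left, so later arguments
  carry only the list \<open>hs\<close> of queried indices.\<close>

lemma best_map_eq_arg_min_list:
  "hs \<noteq> [] \<Longrightarrow> best (map (\<lambda>j. (j, x j)) hs) = arg_min_list x hs"
proof -
  assume "hs \<noteq> []"
  then have "arg_min_list snd (map (\<lambda>j. (j, x j)) hs) = (arg_min_list x hs, x (arg_min_list x hs))"
    by (induction x hs rule: arg_min_list.induct) (auto simp: Let_def)
  then show ?thesis by (simp add: best_def)
qed

lemma measurable_arg_min_list:
  fixes S :: "nat set"
  assumes "hs \<noteq> []" "set hs \<subseteq> S"
  shows "(\<lambda>x. arg_min_list x hs) \<in> measurable (Pi\<^sub>M S (\<lambda>_. borel :: real measure)) (count_space UNIV)"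
  using assms
proof (induction hs rule: induct_list012)
  case (3 a b zs)
  let ?P = "Pi\<^sub>M S (\<lambda>_. borel :: real measure)"
  let ?m = "\<lambda>x. arg_min_list x (b # zs)"
  have m: "?m \<in> measurable ?P (count_space UNIV)" using 3 by simp
  have comp: "Measurable.pred ?P (\<lambda>x. x a \<le> x k)" if "k \<in> S" for k
  proof -
    have "(\<lambda>x. x a) \<in> borel_measurable ?P" "(\<lambda>x. x k) \<in> borel_measurable ?P"
      using that 3 by (auto intro: measurable_component_singleton)
    then show ?thesis by (rule borel_measurable_le[unfolded pred_def[symmetric]])
  qed
  \<comment> \<open>The index \<open>?m x\<close> itself depends on \<open>x\<close>; as it takes
    finitely many values, the comparison becomes a finite union of measurable events.\<close>
  have eq: "(\<lambda>x. x a \<le> x (?m x)) = (\<lambda>x. \<exists>k\<in>set (b # zs). ?m x = k \<and> x a \<le> x k)"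
    using arg_min_list_in[of "b # zs"] by fastforce
  have "Measurable.pred ?P (\<lambda>x. \<exists>k\<in>set (b # zs). ?m x = k \<and> x a \<le> x k)"
  proof (intro pred_intros_finite pred_intros_logic)
    fix k assume "k \<in> set (b # zs)"
    then show "Measurable.pred ?P (\<lambda>x. x a \<le> x k)" using comp 3 by auto
    show "Measurable.pred ?P (\<lambda>x. ?m x = k)" using m by measurable
  qed simp
  then have "Measurable.pred ?P (\<lambda>x. x a \<le> x (?m x))" by (subst eq)
  with m show ?case by (simp add: Let_def)
qed simp_all

lemma is_arg_min_arg_min_list:
  assumes "set hs \<subseteq> S" "hs \<noteq> []" "\<And>j. j \<in> S \<Longrightarrow> \<exists>k\<in>set hs. x k \<le> (x j :: real)"
  shows "is_arg_min x (\<lambda>i. i \<in> S) (arg_min_list x hs)"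
proof -
  have "x (arg_min_list x hs) \<le> x k" if "k \<in> set hs" for k
    using that f_arg_min_list_f[OF assms(2), of x] by simp
  then show ?thesis using arg_min_list_in[OF assms(2), of x] assms(1,3)
    by (force simp: is_arg_min_def not_less)
qed

section \<open>Strategy (i): admissibility, measurability and run of the cascade\<close>

lemma admissible_cascade:
  "distinct is \<Longrightarrow> set is \<subseteq> S \<Longrightarrow> admissible (cascade l is h) S"
proof (induction "is" arbitrary: h S)
  case (Cons i js)
  have "set js \<subseteq> S - {i}" "set js \<subseteq> S" using Cons.prems by auto
  then show ?case using Cons by simp
qed simp

text \<open>The history, and with it the remaining tree, varies with \<open>x\<close>; only the
  index list \<open>hs\<close> is fixed. Each test against \<open>l i\<close> is then a measurable
  case split.\<close>

lemma measurable_cascade: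
  fixes S :: "nat set"
  assumes "set is \<subseteq> S" "set hs \<subseteq> S" "hs \<noteq> []"
  shows "Measurable.pred (Pi\<^sub>M S (\<lambda>_. borel))
      (\<lambda>x. k \<in> queried (cascade l is (map (\<lambda>j. (j, x j)) hs)) x)" (is "?Q is hs")
    and "(\<lambda>x. outcome (cascade l is (map (\<lambda>j. (j, x j)) hs)) x)
      \<in> measurable (Pi\<^sub>M S (\<lambda>_. borel)) (count_space UNIV)" (is "?O is hs")
proof -
  have "?Q is hs \<and> ?O is hs"
    using assms
  proof (induction "is" arbitrary: hs)
    case Nil
    then show ?case by (simp add: best_map_eq_arg_min_list measurable_arg_min_list)
  next
    case (Cons i js)
    have IH1: "?Q js (i # hs)" "?O js (i # hs)" using Cons.IH[of "i # hs"] Cons.prems by auto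
    have IH2: "?Q js hs" "?O js hs" using Cons.IH[of hs] Cons.prems by auto
    have c: "Measurable.pred (Pi\<^sub>M S (\<lambda>_. borel)) (\<lambda>x. \<forall>j\<in>set hs. l i < x j)"
      using Cons.prems
      by (intro pred_intros_finite borel_measurable_pred_less)
        (auto intro: measurable_component_singleton)
    show ?case
    proof
      have "?Q (i # js) hs \<longleftrightarrow> Measurable.pred (Pi\<^sub>M S (\<lambda>_. borel))
         (\<lambda>x. if \<forall>j\<in>set hs. l i < x j
              then k = i \<or> k \<in> queried (cascade l js (map (\<lambda>j. (j, x j)) (i # hs))) x
              else k \<in> queried (cascade l js (map (\<lambda>j. (j, x j)) hs)) x)"
        by (intro arg_cong[where f="Measurable.pred _"] ext) auto
      also have "\<dots>" using c IH1(1) IH2(1) by measurable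
      finally show "?Q (i # js) hs" .
      have "?O (i # js) hs \<longleftrightarrow>
         (\<lambda>x. if \<forall>j\<in>set hs. l i < x j
              then outcome (cascade l js (map (\<lambda>j. (j, x j)) (i # hs))) x
              else outcome (cascade l js (map (\<lambda>j. (j, x j)) hs)) x)
         \<in> measurable (Pi\<^sub>M S (\<lambda>_. borel)) (count_space UNIV)"
        by (intro arg_cong[where f="\<lambda>f. f \<in> _"] ext) auto
      also have "\<dots>" using c IH1(2) IH2(2) by (intro measurable_If) auto
      finally show "?O (i # js) hs" .
    qed
  qed
  then show "?Q is hs" "?O is hs" by auto
qed

text \<open>Invariant: \<open>hs\<close> lists the queried indices below \<open>m\<close>, and each
  skipped \<open>j\<close> has a queried \<open>k\<close> with \<open>x k \<le> l j\<close>. Such a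
  \<open>j\<close> cannot beat \<open>k\<close>, since \<open>l j < x j\<close>. By monotonicity of
  \<open>l\<close>, testing the queried values against \<open>l m\<close> amounts to testing all
  values before \<open>m\<close>.\<close>

lemma cascade_upt:
  assumes mono: "mono_on {1..n} l" and gt: "\<And>i. i \<in> {1..n} \<Longrightarrow> l i < x i"
    and "1 \<le> m" "m \<le> Suc n" "hs \<noteq> []" "set hs \<subseteq> {1..<m}"
    and "\<And>j. j \<in> {1..<m} - set hs \<Longrightarrow> \<exists>k\<in>set hs. x k \<le> l j"
  shows "queried (cascade l [m..<Suc n] (map (\<lambda>j. (j, x j)) hs)) x
      = {i \<in> {m..n}. \<forall>j\<in>{1..<i}. l i < x j} \<and>
    is_arg_min x (\<lambda>i. i \<in> {1..n}) (outcome (cascade l [m..<Suc n] (map (\<lambda>j. (j, x j)) hs)) x)"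
  using assms(3-)
proof (induction "Suc n - m" arbitrary: m hs)
  case 0
  then have m: "m = Suc n" by simp
  have "\<exists>k\<in>set hs. x k \<le> x j" if j: "j \<in> {1..n}" for j
  proof (cases "j \<in> set hs")
    case False
    then obtain k where "k \<in> set hs" "x k \<le> l j" using 0(6)[of j] j m by auto
    then show ?thesis using gt[OF j] by (intro bexI[of _ k]) auto
  qed auto
  then have "is_arg_min x (\<lambda>i. i \<in> {1..n}) (arg_min_list x hs)"
    using 0(4,5) m by (intro is_arg_min_arg_min_list) auto
  then show ?case using 0(4) m by (simp add: best_map_eq_arg_min_list)
next
  case (Suc d)
  then have m: "m < Suc n" by simp
  then have upt: "[m..<Suc n] = m # [Suc m..<Suc n]" by (simp add: upt_conv_Cons)
  have split: "{i \<in> {m..n}. \<forall>j\<in>{1..<i}. l i < x j} =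
    (if \<forall>j\<in>{1..<m}. l m < x j then {m} else {}) \<union> {i \<in> {Suc m..n}. \<forall>j\<in>{1..<i}. l i < x j}"
    using m by (auto simp: le_eq_less_or_eq Suc_le_eq)
  show ?case
  proof (cases "\<forall>j\<in>set hs. l m < x j")
    case True
    \<comment> \<open>Nothing has been skipped yet: the witness \<open>k\<close> of a skipped
      \<open>j\<close> would satisfy \<open>x k \<le> l j \<le> l m\<close> and fail the
      test.\<close>
    have "j \<in> set hs" if j: "j \<in> {1..<m}" for j
    proof (rule ccontr)
      assume "j \<notin> set hs"
      then obtain k where "k \<in> set hs" "x k \<le> l j" using Suc.prems(5)[of j] j by blast
      moreover have "l j \<le> l m" using mono_onD[OF mono, of j m] j m Suc.prems by auto
      ultimately show False using True by force
    qed
    then have "\<forall>j\<in>{1..<m}. l m < x j" using True by auto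
    moreover have "queried (cascade l [Suc m..<Suc n] (map (\<lambda>j. (j, x j)) (m # hs))) x
      = {i \<in> {Suc m..n}. \<forall>j\<in>{1..<i}. l i < x j} \<and>
    is_arg_min x (\<lambda>i. i \<in> {1..n}) (outcome (cascade l [Suc m..<Suc n] (map (\<lambda>j. (j, x j)) (m # hs))) x)"
      by (rule Suc.hyps(1)) (use Suc m in \<open>auto simp: less_Suc_eq\<close>)
    ultimately show ?thesis using True unfolding split upt by auto
  next
    case False
    \<comment> \<open>The value failing the test is the witness that the invariant requires for the
      skipped \<open>m\<close>.\<close>
    then obtain k where k: "k \<in> set hs" "x k \<le> l m" by force
    then have "\<not> (\<forall>j\<in>{1..<m}. l m < x j)" using Suc.prems by force
    moreover have "queried (cascade l [Suc m..<Suc n] (map (\<lambda>j. (j, x j)) hs)) x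
      = {i \<in> {Suc m..n}. \<forall>j\<in>{1..<i}. l i < x j} \<and>
    is_arg_min x (\<lambda>i. i \<in> {1..n}) (outcome (cascade l [Suc m..<Suc n] (map (\<lambda>j. (j, x j)) hs)) x)"
      by (rule Suc.hyps(1)) (use Suc m k in \<open>auto simp: less_Suc_eq\<close>)
    ultimately show ?thesis using False unfolding split upt by auto
  qed
qed

lemma strategy_i_run:
  assumes "mono_on {1..n} l" "\<And>i. i \<in> {1..n} \<Longrightarrow> l i < x i" "1 \<le> n"
  shows "queried (strategy_i n l) x = insert 1 {i \<in> {2..n}. \<forall>j\<in>{1..<i}. l i < x j}"
    and "is_arg_min x (\<lambda>i. i \<in> {1..n}) (outcome (strategy_i n l) x)"
proof -
  have "set [1] \<subseteq> {1..<2::nat}" by auto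
  then show "queried (strategy_i n l) x = insert 1 {i \<in> {2..n}. \<forall>j\<in>{1..<i}. l i < x j}"
    and "is_arg_min x (\<lambda>i. i \<in> {1..n}) (outcome (strategy_i n l) x)"
    using cascade_upt[OF assms(1,2), of 2 "[1]"] assms(3) by (auto simp: strategy_i_def)
qed

lemma admissible_strategy_i: "1 \<le> n \<Longrightarrow> admissible (strategy_i n l) {1..n}"
  unfolding strategy_i_def by (auto intro!: admissible_cascade)

lemma measurable_strategy_i:
  assumes "1 \<le> n" shows "measurable_strategy n (strategy_i n l)"
proof -
  have "set [2..<Suc n] \<subseteq> {1..n}" "set [1] \<subseteq> {1..n}" using assms by auto
  note * = measurable_cascade[OF this, where l = l]
  have run: "queried (strategy_i n l) x = insert 1 (queried (cascade l [2..<Suc n] (map (\<lambda>j. (j, x j)) [1])) x)"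
    "outcome (strategy_i n l) x = outcome (cascade l [2..<Suc n] (map (\<lambda>j. (j, x j)) [1])) x" for x
    by (simp_all add: strategy_i_def del: upt_Suc)
  show ?thesis unfolding measurable_strategy_def run run(2)[abs_def] insert_iff
    using * by (intro conjI allI pred_intros_logic) auto
qed

section \<open>Strategy (ii): run, measurability and correctness\<close>

lemma run_query_all:
  "queried (query_all is \<kappa> h) x = set is \<union> queried (\<kappa> (map (\<lambda>j. (j, x j)) (rev is) @ h)) x"
  "outcome (query_all is \<kappa> h) x = outcome (\<kappa> (map (\<lambda>j. (j, x j)) (rev is) @ h)) x"
  by (induction "is" arbitrary: h) auto

lemma strategy_ii_run:
  assumes "2 \<le> n"
  shows "queried (strategy_ii n r) x = {2..n} \<union> (if \<exists>i\<in>{2..n}. x i < r 1 then {1} else {})"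
    and "outcome (strategy_ii n r) x =
      (if \<exists>i\<in>{2..n}. x i < r 1 then arg_min_list x (1 # rev [2..<Suc n]) else 1)"
proof -
  have "best ((1, x 1) # map (\<lambda>j. (j, x j)) (rev [2..<Suc n])) = arg_min_list x (1 # rev [2..<Suc n])"
    using best_map_eq_arg_min_list[of "1 # rev [2..<Suc n]" x] by simp
  moreover have "set [2..<Suc n] = {2..n}" by auto
  ultimately show "queried (strategy_ii n r) x = {2..n} \<union> (if \<exists>i\<in>{2..n}. x i < r 1 then {1} else {})"
    and "outcome (strategy_ii n r) x =
      (if \<exists>i\<in>{2..n}. x i < r 1 then arg_min_list x (1 # rev [2..<Suc n]) else 1)"
    unfolding strategy_ii_def run_query_all by (auto simp del: upt_Suc rev_map)
qed

lemma admissible_query_all: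
  assumes "distinct is" "set is \<subseteq> S" "\<And>h. admissible (\<kappa> h) (S - set is)"
  shows "admissible (query_all is \<kappa> h) S"
  using assms
proof (induction "is" arbitrary: h S)
  case (Cons i js)
  have "S - set (i # js) = S - {i} - set js" by auto
  moreover have "set js \<subseteq> S - {i}" using Cons.prems by auto
  ultimately show ?case using Cons by auto
qed simp

lemma admissible_strategy_ii: "2 \<le> n \<Longrightarrow> admissible (strategy_ii n r) {1..n}"
  unfolding strategy_ii_def by (intro admissible_query_all) auto

lemma measurable_strategy_ii:
  assumes "2 \<le> n" shows "measurable_strategy n (strategy_ii n r)"
proof -
  let ?P = "Pi\<^sub>M {1..n} (\<lambda>_. borel :: real measure)"
  have c: "Measurable.pred ?P (\<lambda>x. \<exists>i\<in>{2..n}. x i < r 1)"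
    by (intro pred_intros_finite borel_measurable_pred_less)
      (auto intro: measurable_component_singleton)
  have "Measurable.pred ?P (\<lambda>x. k \<in> queried (strategy_ii n r) x)" for k
    unfolding strategy_ii_run[OF assms] using c by (cases "k \<in> {2..n}"; cases "k = 1") auto
  moreover have "outcome (strategy_ii n r) \<in> measurable ?P (count_space UNIV)"
    unfolding strategy_ii_run(2)[OF assms, abs_def] using c assms
    by (intro measurable_If measurable_arg_min_list) auto
  ultimately show ?thesis by (simp add: measurable_strategy_def)
qed

text \<open>If interval 1 stays unqueried, then \<open>x 1 < r 1 \<le> x i\<close> for every other
  \<open>i\<close>, so the unseen value is the minimum.\<close>

lemma strategy_ii_correct:
  assumes "2 \<le> n" "x 1 < r 1"
  shows "is_arg_min x (\<lambda>i. i \<in> {1..n}) (outcome (strategy_ii n r) x)"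
proof (cases "\<exists>i\<in>{2..n}. x i < r 1")
  case True
  have s: "set (1 # rev [2..<Suc n]) = {1..n}" using assms by auto
  have "is_arg_min x (\<lambda>i. i \<in> {1..n}) (arg_min_list x (1 # rev [2..<Suc n]))"
    by (rule is_arg_min_arg_min_list) (unfold s, auto)
  then show ?thesis unfolding strategy_ii_run(2)[OF assms(1)] using True by simp
next
  case False
  have "x 1 \<le> x i" if "i \<in> {1..n}" for i
  proof (cases "i = 1")
    case ne: False
    then have "i \<in> {2..n}" using that by auto
    then have "r 1 \<le> x i" using False by force
    then show ?thesis using assms by simp
  qed simp
  then show ?thesis unfolding strategy_ii_run(2)[OF assms(1)] using False assms
    by (auto simp: is_arg_min_def not_less)
qed

section \<open>The numerical inequality behind the factor 3/2\<close>

text \<open>With \<open>a\<close> for \<open>w 1\<close>, the two terms of the minimum bound the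
  excesses of (i) and (ii) over their common part. Equality holds at \<open>p = 1 / 2\<close>,
  \<open>a = W\<close>.\<close>

lemma three_halves_bound:
  fixes p a W :: real
  assumes "0 \<le> p" "p \<le> 1" "0 < a" "0 < W"
  shows "min (p * a) ((1 - p) * W) \<le> ((1 - p) * a + p * W) / 2"
proof (rule ccontr)
  assume "\<not> ?thesis"
  then have "(1 - p) * a + p * W < 2 * (p * a)" "(1 - p) * a + p * W < 2 * ((1 - p) * W)"
    by (auto simp: min_def split: if_splits)
  then have 1: "(3 * p - 1) * a > p * W" and 2: "(2 - 3 * p) * W > (1 - p) * a"
    by (simp_all add: algebra_simps)
  \<comment> \<open>Multiplying the two strict inequalities, whose smaller sides are nonnegative,
    lets \<open>a * W\<close> cancel and leaves an inequality in \<open>p\<close> alone.\<close>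
  have "(p * W) * ((1 - p) * a) < ((3 * p - 1) * a) * ((2 - 3 * p) * W)"
    using assms by (intro mult_strict_mono'[OF 1 2]) auto
  then have "(p * (1 - p)) * (a * W) < ((3 * p - 1) * (2 - 3 * p)) * (a * W)"
    by (simp add: algebra_simps)
  then have "p * (1 - p) < (3 * p - 1) * (2 - 3 * p)"
    using assms by (simp add: mult_less_cancel_right)
  moreover have "(3 * p - 1) * (2 - 3 * p) - p * (1 - p) = - 2 * (2 * p - 1)\<^sup>2"
    by (simp add: algebra_simps power2_eq_square)
  ultimately show False using zero_le_power2[of "2 * p - 1"] by linarith
qed


section \<open>The probabilistic setting\<close>

text \<open>Refutes a strategy: an almost sure property of resampled values must be met by some
  sample in any event of positive probability.\<close>

lemma (in prob_space) AE_and_prob_pos_imp_ex: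
  assumes "AE \<omega> in M. P \<omega>" "\<P>(\<omega> in M. Q \<omega>) > 0"
  shows "\<exists>\<omega>. P \<omega> \<and> Q \<omega>"
proof (rule ccontr)
  assume "\<not> ?thesis"
  then have "P \<omega> \<Longrightarrow> \<omega> \<notin> {\<omega> \<in> space M. Q \<omega>}" for \<omega> by auto
  with assms(1) have "AE \<omega> in M. \<omega> \<notin> {\<omega> \<in> space M. Q \<omega>}"
    by (rule eventually_mono)
  \<comment> \<open>Positive probability forces measurability, because \<open>measure\<close> is 0
    outside the sigma-algebra.\<close>
  moreover have "{\<omega> \<in> space M. Q \<omega>} \<in> events"
    using assms(2) measure_notin_sets by fastforce
  ultimately show False using assms(2) prob_eq_0 by force
qed

text \<open>The last two assumptions are endpoint forms of the interval conditions: intersecting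
  intervals give \<open>l i < r j\<close>, and as \<open>l 1 \<le> l j\<close>, non-containment of
  interval \<open>j\<close> in interval 1 gives \<open>r 1 < r j\<close>.\<close>

locale stochastic_minimum = prob_space M for M :: "'a measure" +
  fixes v :: "nat \<Rightarrow> 'a \<Rightarrow> real" and n :: nat and l r w :: "nat \<Rightarrow> real"
  assumes two_le: "2 \<le> n"
    and w_pos: "i \<in> {1..n} \<Longrightarrow> w i > 0"
    and indep: "indep_vars (\<lambda>_. borel) v {1..n}"
    and supp: "i \<in> {1..n} \<Longrightarrow> AE \<omega> in M. v i \<omega> \<in> {l i<..<r i}"
    and prob_low: "i \<in> {1..n} \<Longrightarrow> \<epsilon> > 0 \<Longrightarrow> \<P>(\<omega> in M. v i \<omega> < l i + \<epsilon>) > 0"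
    and prob_high: "i \<in> {1..n} \<Longrightarrow> \<epsilon> > 0 \<Longrightarrow> \<P>(\<omega> in M. v i \<omega> > r i - \<epsilon>) > 0"
    and mono: "mono_on {1..n} l"
    and l_less_r: "i \<in> {1..n} \<Longrightarrow> j \<in> {1..n} \<Longrightarrow> l i < r j"
    and r_1_less: "j \<in> {2..n} \<Longrightarrow> r 1 < r j"
begin

abbreviation V :: "'a \<Rightarrow> nat \<Rightarrow> real" where "V \<omega> \<equiv> (\<lambda>i. v i \<omega>)"

abbreviation "PR \<equiv> Pi\<^sub>M {1..n} (\<lambda>_. borel :: real measure)"

lemma one_mem: "1 \<in> {1..n}"
  using two_le by auto

lemma rv: "i \<in> {1..n} \<Longrightarrow> v i \<in> borel_measurable M"
  using indep unfolding indep_vars_def by auto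

lemma measurable_restrict_V: "(\<lambda>\<omega>. restrict (V \<omega>) {1..n}) \<in> measurable M PR"
  by (intro measurable_restrict rv)

lemma l_mono: "1 \<le> i \<Longrightarrow> i \<le> j \<Longrightarrow> j \<le> n \<Longrightarrow> l i \<le> l j"
  using mono by (auto simp: mono_on_def)

lemma AE_supp: "AE \<omega> in M. \<forall>i\<in>{1..n}. v i \<omega> \<in> {l i<..<r i}"
  by (intro AE_finite_allI supp) auto

lemma prob_Ball:
  assumes "J \<subseteq> {1..n}" "\<And>j. j \<in> J \<Longrightarrow> A j \<in> sets borel"
  shows "\<P>(\<omega> in M. \<forall>j\<in>J. v j \<omega> \<in> A j) = (\<Prod>j\<in>J. \<P>(\<omega> in M. v j \<omega> \<in> A j))"
proof (cases "J = {}")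
  case True
  then show ?thesis by (simp add: prob_space)
next
  case False
  have "finite J" using assms(1) finite_subset by blast
  have "{\<omega> \<in> space M. \<forall>j\<in>J. v j \<omega> \<in> A j} = (\<Inter>j\<in>J. v j -` A j \<inter> space M)"
    using False by auto
  then have "\<P>(\<omega> in M. \<forall>j\<in>J. v j \<omega> \<in> A j) = (\<Prod>j\<in>J. prob (v j -` A j \<inter> space M))"
    using indep_varsD[OF indep False \<open>finite J\<close> assms(1), of A] assms(2) by simp
  also have "\<dots> = (\<Prod>j\<in>J. \<P>(\<omega> in M. v j \<omega> \<in> A j))"
    by (intro prod.cong refl arg_cong[where f = prob]) auto
  finally show ?thesis .
qed

lemma pred_queried:
  assumes "admissible \<sigma> {1..n}" "measurable_strategy n \<sigma>"
  shows "Measurable.pred M (\<lambda>\<omega>. k \<in> queried \<sigma> (V \<omega>))"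
proof -
  have "Measurable.pred PR (\<lambda>x. k \<in> queried \<sigma> x)"
    using assms(2) by (simp add: measurable_strategy_def)
  from measurable_compose[OF measurable_restrict_V this] show ?thesis
    by (simp only: restrict_outcome_queried[OF assms(1)])
qed

text \<open>Linearity of expectation. From here on only the probabilities of the individual queries
  matter.\<close>

lemma expected_cost_eq:
  assumes "admissible \<sigma> {1..n}" "measurable_strategy n \<sigma>"
  shows "expected_cost M v w \<sigma> = (\<Sum>i=1..n. w i * \<P>(\<omega> in M. i \<in> queried \<sigma> (V \<omega>)))"
proof -
  let ?E = "\<lambda>i. {\<omega> \<in> space M. i \<in> queried \<sigma> (V \<omega>)}"
  have E: "?E i \<in> events" for i
    using pred_queried[OF assms, of i] by (simp add: pred_def)
  have "cost w \<sigma> (V \<omega>) = (\<Sum>i=1..n. w i * indicator (?E i) \<omega>)" if "\<omega> \<in> space M" for \<omega>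
  proof -
    have "(\<Sum>i=1..n. w i * indicator (?E i) \<omega>) = (\<Sum>i=1..n. if i \<in> queried \<sigma> (V \<omega>) then w i else 0)"
      using that by (intro sum.cong) (auto simp: indicator_def)
    also have "\<dots> = sum w ({1..n} \<inter> queried \<sigma> (V \<omega>))"
      by (simp add: sum.inter_restrict)
    also have "{1..n} \<inter> queried \<sigma> (V \<omega>) = queried \<sigma> (V \<omega>)"
      using queried_subset[OF assms(1)] by blast
    finally show ?thesis using cost_eq_sum_queried[OF assms(1)] by simp
  qed
  then have "expected_cost M v w \<sigma> = (\<integral>\<omega>. (\<Sum>i=1..n. w i * indicator (?E i) \<omega>) \<partial>M)"
    unfolding expected_cost_def by (intro Bochner_Integration.integral_cong) auto
  also have "\<dots> = (\<Sum>i=1..n. \<integral>\<omega>. w i * indicator (?E i) \<omega> \<partial>M)"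
    by (intro Bochner_Integration.integral_sum integrable_mult_right integrable_real_indicator E)
      (simp add: emeasure_eq_measure)
  also have "\<dots> = (\<Sum>i=1..n. w i * prob (?E i))"
    using E by simp
  finally show ?thesis .
qed

section \<open>Resampling and the queries that it forces\<close>

text \<open>The values inside and outside \<open>K\<close> are independent, so replacing those in
  \<open>K\<close> by an independent copy preserves the joint law. Fubini for null sets then
  separates the two samples.\<close>

lemma AE_resample:
  assumes "K \<subseteq> {1..n}" "Measurable.pred PR P" "AE \<omega> in M. P (restrict (V \<omega>) {1..n})"
  shows "AE \<omega> in M. AE \<omega>' in M. P (\<lambda>j\<in>{1..n}. if j \<in> K then v j \<omega>' else v j \<omega>)"
proof -
  define L where "L = {1..n} - K"
  have LK: "L \<inter> K = {}" "L \<union> K = {1..n}" "L \<subseteq> {1..n}" using assms(1) by (auto simp: L_def)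
  let ?X = "\<lambda>\<omega>. restrict (V \<omega>) L" and ?Y = "\<lambda>\<omega>. restrict (V \<omega>) K"
  let ?S = "Pi\<^sub>M L (\<lambda>_. borel :: real measure)" and ?T = "Pi\<^sub>M K (\<lambda>_. borel :: real measure)"
  have ind: "indep_var ?S ?X ?T ?Y"
    by (rule indep_var_restrict[OF indep LK(1) LK(3) assms(1)])
  then have X: "random_variable ?S ?X" and Y: "random_variable ?T ?Y"
    and eq: "distr M ?S ?X \<Otimes>\<^sub>M distr M ?T ?Y = distr M (?S \<Otimes>\<^sub>M ?T) (\<lambda>\<omega>. (?X \<omega>, ?Y \<omega>))"
    by (auto simp: indep_var_distribution_eq)
  interpret X: prob_space "distr M ?S ?X" by (rule prob_space_distr) fact
  interpret Y: prob_space "distr M ?T ?Y" by (rule prob_space_distr) fact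
  interpret XY: pair_prob_space "distr M ?S ?X" "distr M ?T ?Y" ..
  have mix: "merge L K (?X \<omega>, ?Y \<omega>') = (\<lambda>j\<in>{1..n}. if j \<in> K then v j \<omega>' else v j \<omega>)" for \<omega> \<omega>'
    using LK by (auto simp: merge_def fun_eq_iff)
  \<comment> \<open>The joint law only sees the diagonal, where the mixed vector is the original
    one.\<close>
  have self: "(\<lambda>j\<in>{1..n}. if j \<in> K then v j \<omega> else v j \<omega>) = restrict (V \<omega>) {1..n}" for \<omega>
    by auto
  have "Measurable.pred (?S \<Otimes>\<^sub>M ?T) (\<lambda>z. P (merge L K z))"
    using measurable_compose[OF measurable_merge[of L K "\<lambda>_. borel"], of P] assms(2) LK(2) by simp
  then have "{z \<in> space (?S \<Otimes>\<^sub>M ?T). P (merge L K z)} \<in> sets (?S \<Otimes>\<^sub>M ?T)"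
    by (simp add: pred_def)
  then have "AE z in distr M (?S \<Otimes>\<^sub>M ?T) (\<lambda>\<omega>. (?X \<omega>, ?Y \<omega>)). P (merge L K z)"
    using assms(3) by (subst AE_distr_iff) (auto simp only: mix self intro!: measurable_Pair X Y)
  then have "AE x in distr M ?S ?X. AE y in distr M ?T ?Y. P (merge L K (x, y))"
    unfolding eq[symmetric] by (rule XY.AE_pair)
  from AE_distrD[OF X this] show ?thesis
  proof eventually_elim
    case (elim \<omega>)
    from AE_distrD[OF Y this] show ?case by (simp only: mix)
  qed
qed

text \<open>Changing unqueried values does not change the answer, so the answer given for
  \<open>\<omega>\<close> must stay correct for almost every new choice of those values.\<close>

lemma AE_resample_unqueried:
  assumes "solves_minimum M v n \<sigma>" "K \<subseteq> {1..n}"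
  shows "AE \<omega> in M. K \<inter> queried \<sigma> (V \<omega>) = {} \<longrightarrow> (AE \<omega>' in M.
    is_arg_min (\<lambda>j. if j \<in> K then v j \<omega>' else v j \<omega>) (\<lambda>i. i \<in> {1..n}) (outcome \<sigma> (V \<omega>)))"
proof -
  from assms(1) have adm: "admissible \<sigma> {1..n}" and meas: "measurable_strategy n \<sigma>"
    and AE: "AE \<omega> in M. is_arg_min (V \<omega>) (\<lambda>i. i \<in> {1..n}) (outcome \<sigma> (V \<omega>))"
    by (auto simp: solves_minimum_def)
  define P where "P x \<longleftrightarrow> is_arg_min x (\<lambda>i. i \<in> {1..n}) (outcome \<sigma> x)" for x
  have P_restrict: "P (restrict x {1..n}) \<longleftrightarrow> P x" for x
    unfolding P_def is_arg_min_def restrict_outcome_queried[OF adm]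
    by (intro conj_cong refl arg_cong[where f = Not] arg_cong[where f = Ex] ext) auto
  \<comment> \<open>A form with finite quantifiers and a fixed index \<open>k\<close>, from which
    measurability can be read off.\<close>
  have P_iff: "P x \<longleftrightarrow> (\<exists>k\<in>{1..n}. outcome \<sigma> x = k \<and> (\<forall>j\<in>{1..n}. \<not> x j < x k))" for x
    by (auto simp: P_def is_arg_min_def)
  have out: "outcome \<sigma> \<in> measurable PR (count_space UNIV)"
    using meas by (simp add: measurable_strategy_def)
  have "Measurable.pred PR (\<lambda>x. outcome \<sigma> x = k)" for k
    using out by measurable
  then have "Measurable.pred PR P"
    unfolding P_iff[abs_def]
    by (intro pred_intros_finite pred_intros_logic borel_measurable_pred_less
        measurable_component_singleton) auto
  moreover have "AE \<omega> in M. P (restrict (V \<omega>) {1..n})"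
    using AE unfolding P_restrict by (simp add: P_def)
  ultimately have "AE \<omega> in M. AE \<omega>' in M. P (\<lambda>j. if j \<in> K then v j \<omega>' else v j \<omega>)"
    using AE_resample[OF assms(2), of P] by (simp only: P_restrict)
  then show ?thesis
  proof eventually_elim
    case (elim \<omega>)
    show ?case
    proof
      assume K: "K \<inter> queried \<sigma> (V \<omega>) = {}"
      from elim show "AE \<omega>' in M.
        is_arg_min (\<lambda>j. if j \<in> K then v j \<omega>' else v j \<omega>) (\<lambda>i. i \<in> {1..n}) (outcome \<sigma> (V \<omega>))"
      proof eventually_elim
        case (elim \<omega>')
        have "outcome \<sigma> (\<lambda>j. if j \<in> K then v j \<omega>' else v j \<omega>) = outcome \<sigma> (V \<omega>)"
          using K by (intro agree_on_queried[THEN conjunct2]) auto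
        with elim show ?case by (simp add: P_def)
      qed
    qed
  qed
qed

text \<open>The intervals 1 and \<open>i\<close> overlap, so the midpoint \<open>c\<close> of
  \<open>l i\<close> and \<open>r 1\<close> separates two independent events of positive
  probability, \<open>v i < c\<close> and \<open>c < v 1\<close>.\<close>

lemma prob_1_above_i_pos:
  assumes "i \<in> {2..n}"
  shows "\<P>(\<omega> in M. v i \<omega> < v 1 \<omega>) > 0"
proof -
  define c where "c = (l i + r 1) / 2"
  have i: "i \<in> {1..n}" "i \<noteq> 1" using assms by auto
  have "l i < r 1" using l_less_r i one_mem by blast
  \<comment> \<open>The trivial equations write \<open>c\<close> as an offset from each endpoint, to
    match \<open>prob_low\<close> and \<open>prob_high\<close>.\<close>
  then have c: "l i + (c - l i) = c" "r 1 - (r 1 - c) = c" "c - l i > 0" "r 1 - c > 0"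
    by (auto simp: c_def field_simps)
  define A where "A j = (if j = 1 then {c<..} else {..<c})" for j :: nat
  have "0 < \<P>(\<omega> in M. v 1 \<omega> \<in> A 1) * \<P>(\<omega> in M. v i \<omega> \<in> A i)"
    using prob_low[OF i(1) c(3)] prob_high[OF one_mem c(4)] c i by (auto simp: A_def)
  also have "\<dots> = \<P>(\<omega> in M. \<forall>j\<in>{1,i}. v j \<omega> \<in> A j)"
    using i one_mem by (subst prob_Ball) (auto simp: A_def)
  also have "\<dots> \<le> \<P>(\<omega> in M. v i \<omega> < v 1 \<omega>)"
  proof (rule finite_measure_mono)
    show "{\<omega> \<in> space M. v i \<omega> < v 1 \<omega>} \<in> events"
      using rv[OF i(1)] rv[OF one_mem] by measurable
  qed (use i in \<open>auto simp: A_def\<close>)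
  finally show ?thesis .
qed

text \<open>A hidden \<open>v 1\<close> may lie near \<open>l 1\<close>, below all other values, so
  the answer must be 1. It may also lie near \<open>r 1\<close>, so no other value can be below
  \<open>r 1\<close>, and none can remain hidden.\<close>

lemma unqueried_1:
  assumes "solves_minimum M v n \<sigma>"
  shows "AE \<omega> in M. 1 \<notin> queried \<sigma> (V \<omega>) \<longrightarrow> (\<forall>i\<in>{2..n}. i \<in> queried \<sigma> (V \<omega>) \<and> r 1 \<le> v i \<omega>)"
proof -
  have "AE \<omega> in M. \<forall>i\<in>{2..n}. 1 \<notin> queried \<sigma> (V \<omega>) \<longrightarrow> i \<in> queried \<sigma> (V \<omega>) \<and> r 1 \<le> v i \<omega>"
  proof (rule AE_finite_allI)
    fix i assume "i \<in> {2..n}"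
    then have i: "i \<in> {1..n}" "i \<noteq> 1" by auto
    have "{1} \<subseteq> {1..n}" "{1, i} \<subseteq> {1..n}" using i one_mem by auto
    from AE_supp this[THEN AE_resample_unqueried[OF assms]]
    show "AE \<omega> in M. 1 \<notin> queried \<sigma> (V \<omega>) \<longrightarrow> i \<in> queried \<sigma> (V \<omega>) \<and> r 1 \<le> v i \<omega>"
    proof eventually_elim
      case (elim \<omega>)
      let ?k = "outcome \<sigma> (V \<omega>)"
      show ?case
      proof
        assume 1: "1 \<notin> queried \<sigma> (V \<omega>)"
        then have AE1: "AE \<omega>' in M. is_arg_min (\<lambda>j. if j \<in> {1} then v j \<omega>' else v j \<omega>)
            (\<lambda>i. i \<in> {1..n}) ?k"
          using elim(2) by simp
        have k: "?k = 1"
        proof (rule ccontr)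
          assume ne: "?k \<noteq> 1"
          \<comment> \<open>The event \<open>v 1 < l 1 + 1\<close> merely supplies a sample on which
            the answer is correct.\<close>
          have "?k \<in> {1..n}"
            using AE_and_prob_pos_imp_ex[OF AE1 prob_low[OF one_mem, of 1]]
            by (auto simp: is_arg_min_def)
          then have "l 1 < v ?k \<omega>" using elim(1) l_mono[of 1 ?k] by force
          then have "\<P>(\<omega>' in M. v 1 \<omega>' < v ?k \<omega>) > 0"
            using prob_low[OF one_mem, of "v ?k \<omega> - l 1"] by simp
          from AE_and_prob_pos_imp_ex[OF AE1 this] show False
            using ne one_mem
            by (auto simp: is_arg_min_linorder simp del: One_nat_def dest!: spec[of _ 1])
        qed
        have "r 1 \<le> v i \<omega>"
        proof (rule ccontr)
          assume "\<not> r 1 \<le> v i \<omega>"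
          then have "\<P>(\<omega>' in M. v 1 \<omega>' > v i \<omega>) > 0"
            using prob_high[OF one_mem, of "r 1 - v i \<omega>"] by simp
          from AE_and_prob_pos_imp_ex[OF AE1 this] show False
            unfolding k using i by (auto simp: is_arg_min_def)
        qed
        \<comment> \<open>Were \<open>i\<close> unqueried as well, 1 and \<open>i\<close> could be
          resampled together so that \<open>v i < v 1\<close>, refuting the answer 1.\<close>
        moreover have "i \<in> queried \<sigma> (V \<omega>)"
        proof (rule ccontr)
          assume "i \<notin> queried \<sigma> (V \<omega>)"
          with 1 have "AE \<omega>' in M. is_arg_min (\<lambda>j. if j \<in> {1, i} then v j \<omega>' else v j \<omega>)
            (\<lambda>i. i \<in> {1..n}) ?k"
            using elim(3) by simp
          from AE_and_prob_pos_imp_ex[OF this prob_1_above_i_pos[OF \<open>i \<in> {2..n}\<close>]] show False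
            unfolding k using i by (auto simp: is_arg_min_def)
        qed
        ultimately show "i \<in> queried \<sigma> (V \<omega>) \<and> r 1 \<le> v i \<omega>" by simp
      qed
    qed
  qed simp
  then show ?thesis by eventually_elim auto
qed

text \<open>A hidden \<open>v i\<close> refutes any answer. The answer \<open>i\<close> fails when
  \<open>v i\<close> is near \<open>r i\<close>, above \<open>v 1\<close>; another answer
  \<open>k\<close> fails when \<open>v i\<close> is near \<open>l i\<close>, below
  \<open>v k\<close>.\<close>

lemma mandatory_queried:
  assumes "solves_minimum M v n \<sigma>" "i \<in> {2..n}"
  shows "AE \<omega> in M. (\<forall>j\<in>{1..<i}. l i < v j \<omega>) \<longrightarrow> i \<in> queried \<sigma> (V \<omega>)"
proof -
  have i: "i \<in> {1..n}" "i \<noteq> 1" using assms(2) by auto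
  have "{i} \<subseteq> {1..n}" using i by auto
  from AE_supp AE_resample_unqueried[OF assms(1) this] show ?thesis
  proof eventually_elim
    case (elim \<omega>)
    let ?k = "outcome \<sigma> (V \<omega>)"
    show ?case
    proof (intro impI, rule ccontr)
      assume mand: "\<forall>j\<in>{1..<i}. l i < v j \<omega>" and "i \<notin> queried \<sigma> (V \<omega>)"
      then have AEi: "AE \<omega>' in M. is_arg_min (\<lambda>j. if j \<in> {i} then v j \<omega>' else v j \<omega>)
            (\<lambda>i. i \<in> {1..n}) ?k"
        using elim(2) by simp
      then have k: "?k \<in> {1..n}"
        using AE_and_prob_pos_imp_ex[OF AEi prob_low[OF i(1), of 1]]
        by (auto simp: is_arg_min_def)
      show False
      proof (cases "?k = i")
        case True
        have "v 1 \<omega> < r i" using elim(1) one_mem r_1_less[OF assms(2)] by force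
        then have "\<P>(\<omega>' in M. v i \<omega>' > v 1 \<omega>) > 0"
          using prob_high[OF i(1), of "r i - v 1 \<omega>"] by simp
        from AE_and_prob_pos_imp_ex[OF AEi this] show False
          unfolding True using i one_mem
            by (auto simp: is_arg_min_linorder simp del: One_nat_def dest!: spec[of _ 1])
      next
        case False
        \<comment> \<open>For \<open>?k < i\<close> this is the mandatory condition; for larger
          \<open>?k\<close> it follows from the order of the left endpoints.\<close>
        have "l i < v ?k \<omega>"
        proof (cases "?k < i")
          case True
          then show ?thesis using mand k by auto
        next
          case False
          then have "l i \<le> l ?k" using l_mono[of i ?k] i k by auto
          then show ?thesis using elim(1) k by force
        qed
        then have "\<P>(\<omega>' in M. v i \<omega>' < v ?k \<omega>) > 0"
          using prob_low[OF i(1), of "v ?k \<omega> - l i"] by simp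
        from AE_and_prob_pos_imp_ex[OF AEi this] show False
          using False i by (auto simp: is_arg_min_def)
      qed
    qed
  qed
qed

section \<open>Lower bounds on query probabilities\<close>

text \<open>Until interval 1 is queried the run cannot depend on \<open>v 1\<close>, so skipping it
  is an event in the remaining values.\<close>

lemma indep_unqueried_1:
  assumes "admissible \<sigma> {1..n}" "measurable_strategy n \<sigma>"
  shows "\<P>(\<omega> in M. 1 \<notin> queried \<sigma> (V \<omega>) \<and> c < v 1 \<omega>) =
    \<P>(\<omega> in M. 1 \<notin> queried \<sigma> (V \<omega>)) * \<P>(\<omega> in M. c < v 1 \<omega>)"
proof -
  let ?S = "Pi\<^sub>M {2..n} (\<lambda>_. borel :: real measure)" and ?T = "Pi\<^sub>M {1} (\<lambda>_. borel :: real measure)"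
  let ?X = "\<lambda>\<omega>. restrict (V \<omega>) {2..n}" and ?Y = "\<lambda>\<omega>. restrict (V \<omega>) {1}"
  have un: "{1..n} = {2..n} \<union> {1}" using two_le by auto
  have ind: "indep_var ?S ?X ?T ?Y"
    by (rule indep_var_restrict[OF indep]) (use two_le in auto)
  \<comment> \<open>The default 0 fills coordinate 1; any other constant would describe the same
    event.\<close>
  define B where "B = {x \<in> space ?S. 1 \<notin> queried \<sigma> (x(1 := 0))}"
  define C where "C = {x \<in> space ?T. c < x (1::nat)}"
  have upd: "(\<lambda>x. x(1 := 0)) \<in> measurable ?S PR"
    by (rule measurable_fun_upd[OF un]) auto
  have "Measurable.pred PR (\<lambda>x. 1 \<in> queried \<sigma> x)"
    using assms(2) by (simp add: measurable_strategy_def)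
  from measurable_compose[OF upd this] have "Measurable.pred ?S (\<lambda>x. 1 \<notin> queried \<sigma> (x(1 := 0)))"
    by (intro pred_intros_logic)
  then have B: "B \<in> sets ?S" by (simp add: B_def pred_def)
  have "(\<lambda>x. x 1) \<in> borel_measurable ?T" by (intro measurable_component_singleton) simp
  then have C: "C \<in> sets ?T" unfolding C_def by measurable
  have "1 \<in> queried \<sigma> ((?X \<omega>)(1 := 0)) \<longleftrightarrow> 1 \<in> queried \<sigma> (V \<omega>)" for \<omega>
  proof -
    \<comment> \<open>Applied in both directions: if either of the two runs avoids 1, they
      coincide.\<close>
    have *: "queried \<sigma> y = queried \<sigma> x" if "1 \<notin> queried \<sigma> x" "\<And>i. i \<in> {2..n} \<Longrightarrow> x i = y i" for x y
    proof (rule agree_on_queried[THEN conjunct1])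
      fix i assume "i \<in> queried \<sigma> x"
      then show "x i = y i" using queried_subset[OF assms(1), of x] that un by blast
    qed
    show ?thesis
      using *[of "V \<omega>" "(?X \<omega>)(1 := 0)"] *[of "(?X \<omega>)(1 := 0)" "V \<omega>"] by force
  qed
  then have "?X -` B \<inter> space M = {\<omega> \<in> space M. 1 \<notin> queried \<sigma> (V \<omega>)}"
    by (auto simp: B_def space_PiM)
  moreover have "?Y -` C \<inter> space M = {\<omega> \<in> space M. c < v 1 \<omega>}"
    by (auto simp: C_def space_PiM)
  moreover have "(\<lambda>\<omega>. (?X \<omega>, ?Y \<omega>)) -` (B \<times> C) \<inter> space M = (?X -` B \<inter> space M) \<inter> (?Y -` C \<inter> space M)"
    by auto
  moreover have "{\<omega> \<in> space M. 1 \<notin> queried \<sigma> (V \<omega>)} \<inter> {\<omega> \<in> space M. c < v 1 \<omega>}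
      = {\<omega> \<in> space M. 1 \<notin> queried \<sigma> (V \<omega>) \<and> c < v 1 \<omega>}"
    by auto
  ultimately show ?thesis using indep_varD[OF ind B C] by simp
qed

lemma mandatory_event:
  assumes "i \<in> {2..n}"
  shows "{\<omega> \<in> space M. \<forall>j\<in>{1..<i}. l i < v j \<omega>} \<in> events"
proof -
  have "Measurable.pred M (\<lambda>\<omega>. \<forall>j\<in>{1..<i}. l i < v j \<omega>)"
    using assms by (intro pred_intros_finite borel_measurable_pred_less) (auto intro!: rv)
  then show ?thesis by (simp add: pred_def)
qed

text \<open>Interval \<open>i\<close> is queried if it is mandatory (\<open>E\<close>) or if 1 is
  skipped (\<open>B\<close>). Both together force \<open>l i < v 1\<close>, and inclusion-exclusion
  with the independence of \<open>B\<close> and \<open>v 1\<close> gives the second summand.\<close>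

lemma prob_queried_ge:
  assumes "solves_minimum M v n \<sigma>" "i \<in> {2..n}"
  shows "\<P>(\<omega> in M. \<forall>j\<in>{1..<i}. l i < v j \<omega>)
      + \<P>(\<omega> in M. 1 \<notin> queried \<sigma> (V \<omega>)) * (1 - \<P>(\<omega> in M. l i < v 1 \<omega>))
    \<le> \<P>(\<omega> in M. i \<in> queried \<sigma> (V \<omega>))"
proof -
  from assms(1) have adm: "admissible \<sigma> {1..n}" and meas: "measurable_strategy n \<sigma>"
    by (auto simp: solves_minimum_def)
  note [measurable] = pred_queried[OF adm meas] rv[OF one_mem]
  define E where "E = {\<omega> \<in> space M. \<forall>j\<in>{1..<i}. l i < v j \<omega>}"
  define B where "B = {\<omega> \<in> space M. 1 \<notin> queried \<sigma> (V \<omega>)}"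
  define D where "D = {\<omega> \<in> space M. 1 \<notin> queried \<sigma> (V \<omega>) \<and> l i < v 1 \<omega>}"
  have E: "E \<in> events" unfolding E_def by (rule mandatory_event[OF assms(2)])
  have B: "B \<in> events" and D: "D \<in> events"
    unfolding B_def D_def by measurable
  have "E \<inter> B \<subseteq> D" using assms(2) by (auto simp: E_def B_def D_def)
  then have "prob (E \<inter> B) \<le> prob D" using D by (rule finite_measure_mono)
  then have "prob E + prob B - prob D \<le> prob (E \<union> B)"
    using measure_Un3[of E M B] E B by (simp add: fmeasurable_eq_sets)
  also have "\<dots> \<le> \<P>(\<omega> in M. i \<in> queried \<sigma> (V \<omega>))"
  proof (rule finite_measure_mono_AE)
    show "AE \<omega> in M. \<omega> \<in> E \<union> B \<longrightarrow> \<omega> \<in> {\<omega> \<in> space M. i \<in> queried \<sigma> (V \<omega>)}"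
      using unqueried_1[OF assms(1)] mandatory_queried[OF assms]
      by eventually_elim (use assms(2) in \<open>auto simp: E_def B_def\<close>)
  qed measurable
  finally show ?thesis
    using indep_unqueried_1[OF adm meas, of "l i"]
    by (simp add: E_def B_def D_def algebra_simps)
qed

section \<open>Correctness and expected costs of the two strategies\<close>

lemma solves_strategy_i: "solves_minimum M v n (strategy_i n l)"
  unfolding solves_minimum_def
proof (intro conjI)
  show "AE \<omega> in M. is_arg_min (V \<omega>) (\<lambda>i. i \<in> {1..n}) (outcome (strategy_i n l) (V \<omega>))"
    using AE_supp by eventually_elim (rule strategy_i_run(2)[OF mono], use two_le in auto)
  have "1 \<le> n" using two_le by simp
  then show "admissible (strategy_i n l) {1..n}" "measurable_strategy n (strategy_i n l)"
    by (rule admissible_strategy_i, rule measurable_strategy_i)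
qed

lemma solves_strategy_ii: "solves_minimum M v n (strategy_ii n r)"
  unfolding solves_minimum_def
proof (intro conjI)
  show "AE \<omega> in M. is_arg_min (V \<omega>) (\<lambda>i. i \<in> {1..n}) (outcome (strategy_ii n r) (V \<omega>))"
    using supp[OF one_mem] by eventually_elim (rule strategy_ii_correct[OF two_le], auto)
qed (use two_le in \<open>simp_all only: admissible_strategy_ii measurable_strategy_ii\<close>)

lemma sum_split_1: "(\<Sum>i=1..n. f i) = f 1 + (\<Sum>i=2..n. f i)" for f :: "nat \<Rightarrow> real"
  using two_le by (subst sum.atLeast_Suc_atMost) (auto simp: numeral_2_eq_2)

text \<open>By independence, the products in \<open>A_1\<close> are the probabilities of being
  mandatory.\<close>

lemma A_1_eq:
  "A_1 M v n l w = w 1 + (\<Sum>i=2..n. w i * \<P>(\<omega> in M. \<forall>j\<in>{1..<i}. l i < v j \<omega>))"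
proof -
  have "(\<Prod>j\<in>{1..<i}. \<P>(\<omega> in M. l i < v j \<omega>)) = \<P>(\<omega> in M. \<forall>j\<in>{1..<i}. l i < v j \<omega>)"
    if "i \<in> {2..n}" for i
  proof -
    have "{1..<i} \<subseteq> {1..n}" using that by auto
    from prob_Ball[OF this, of "\<lambda>_. {l i<..}"] show ?thesis by simp
  qed
  then show ?thesis unfolding A_1_def sum_split_1 by simp
qed

lemma expected_cost_strategy_i: "expected_cost M v w (strategy_i n l) = A_1 M v n l w"
proof -
  note s = solves_strategy_i[unfolded solves_minimum_def]
  have q: "AE \<omega> in M. queried (strategy_i n l) (V \<omega>) =
      insert 1 {i \<in> {2..n}. \<forall>j\<in>{1..<i}. l i < v j \<omega>}"
    using AE_supp by eventually_elim (rule strategy_i_run(1)[OF mono], use two_le in auto)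
  note [measurable] = pred_queried[OF s[THEN conjunct1] s[THEN conjunct2, THEN conjunct1]]
  have "\<P>(\<omega> in M. 1 \<in> queried (strategy_i n l) (V \<omega>)) = 1"
    using q by (intro prob_Collect_eq_1[THEN iffD2]) (auto elim: eventually_mono)
  moreover have "\<P>(\<omega> in M. i \<in> queried (strategy_i n l) (V \<omega>)) = \<P>(\<omega> in M. \<forall>j\<in>{1..<i}. l i < v j \<omega>)"
    if "i \<in> {2..n}" for i
  proof (rule finite_measure_eq_AE)
    show "AE \<omega> in M. \<omega> \<in> {\<omega> \<in> space M. i \<in> queried (strategy_i n l) (V \<omega>)} \<longleftrightarrow>
        \<omega> \<in> {\<omega> \<in> space M. \<forall>j\<in>{1..<i}. l i < v j \<omega>}"
      using q by eventually_elim (use that in auto)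
    show "{\<omega> \<in> space M. \<forall>j\<in>{1..<i}. l i < v j \<omega>} \<in> events" by (rule mandatory_event[OF that])
  qed measurable
  ultimately show ?thesis
    unfolding A_1_eq expected_cost_eq[OF s[THEN conjunct1] s[THEN conjunct2, THEN conjunct1]] sum_split_1
    by simp
qed

abbreviation "W \<equiv> \<Sum>i=2..n. w i"

text \<open>The weak inequality makes this exactly the probability that (ii) skips interval 1;
  \<open>A_R\<close> uses the strict one.\<close>

abbreviation "p \<equiv> \<P>(\<omega> in M. \<forall>i\<in>{2..n}. r 1 \<le> v i \<omega>)"

lemma p_event: "{\<omega> \<in> space M. \<forall>i\<in>{2..n}. r 1 \<le> v i \<omega>} \<in> events"
proof -
  have "Measurable.pred M (\<lambda>\<omega>. \<forall>i\<in>{2..n}. \<not> v i \<omega> < r 1)"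
    by (intro pred_intros_finite pred_intros_logic borel_measurable_pred_less) (auto intro!: rv)
  then show ?thesis by (simp add: pred_def not_less)
qed

lemma expected_cost_strategy_ii:
  "expected_cost M v w (strategy_ii n r) = W + w 1 * (1 - p)"
proof -
  note s = solves_strategy_ii[unfolded solves_minimum_def]
  have "{\<omega> \<in> space M. 1 \<in> queried (strategy_ii n r) (V \<omega>)} =
      space M - {\<omega> \<in> space M. \<forall>i\<in>{2..n}. r 1 \<le> v i \<omega>}"
    unfolding strategy_ii_run[OF two_le] by (auto simp: not_le not_less)
  then have "\<P>(\<omega> in M. 1 \<in> queried (strategy_ii n r) (V \<omega>)) = 1 - p"
    by (simp only: prob_compl[OF p_event])
  moreover have "\<P>(\<omega> in M. i \<in> queried (strategy_ii n r) (V \<omega>)) = 1" if "i \<in> {2..n}" for i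
    unfolding strategy_ii_run[OF two_le] using that by (simp add: prob_space)
  ultimately show ?thesis
    unfolding expected_cost_eq[OF s[THEN conjunct1] s[THEN conjunct2, THEN conjunct1]] sum_split_1
    by simp
qed

text \<open>Weak and strict inequality differ only on the events \<open>v i = r 1\<close>, which are
  null by assumption.\<close>

lemma expected_cost_strategy_ii_eq_A_R:
  assumes "\<forall>i\<in>{2..n}. \<P>(\<omega> in M. v i \<omega> = r 1) = 0"
  shows "expected_cost M v w (strategy_ii n r) = A_R M v n r w"
proof -
  have "\<P>(\<omega> in M. r 1 < v i \<omega>) = \<P>(\<omega> in M. r 1 \<le> v i \<omega>)" if i: "i \<in> {2..n}" for i
  proof (rule finite_measure_eq_AE)
    have [measurable]: "v i \<in> borel_measurable M" using i by (intro rv) auto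
    have "AE \<omega> in M. v i \<omega> \<noteq> r 1"
      using assms i prob_Collect_eq_0[of "\<lambda>\<omega>. v i \<omega> = r 1"] by simp
    then show "AE \<omega> in M. \<omega> \<in> {\<omega> \<in> space M. r 1 < v i \<omega>} \<longleftrightarrow> \<omega> \<in> {\<omega> \<in> space M. r 1 \<le> v i \<omega>}"
      by eventually_elim auto
    show "{\<omega> \<in> space M. r 1 < v i \<omega>} \<in> events" "{\<omega> \<in> space M. r 1 \<le> v i \<omega>} \<in> events"
      by measurable
  qed
  moreover have "p = (\<Prod>i=2..n. \<P>(\<omega> in M. r 1 \<le> v i \<omega>))"
    using prob_Ball[of "{2..n}" "\<lambda>_. {r 1..}"] by auto
  ultimately show ?thesis unfolding expected_cost_strategy_ii A_R_def by simp
qed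

section \<open>Comparison with an arbitrary correct strategy\<close>

text \<open>If \<open>v 1 > l i\<close> and all other values are at least \<open>r 1 > l i\<close>,
  then \<open>i\<close> is mandatory. This makes the remainder \<open>m\<close> of the final
  estimate nonnegative.\<close>

lemma prob_mandatory_ge:
  assumes i: "i \<in> {2..n}"
  shows "p * \<P>(\<omega> in M. l i < v 1 \<omega>) \<le> \<P>(\<omega> in M. \<forall>j\<in>{1..<i}. l i < v j \<omega>)"
proof -
  define A where "A j = (if j = 1 then {l i<..} else {r 1..})" for j :: nat
  have un: "{1..n} = insert 1 {2..n}" using two_le by auto
  have "p * \<P>(\<omega> in M. l i < v 1 \<omega>) = (\<Prod>j\<in>{1..n}. \<P>(\<omega> in M. v j \<omega> \<in> A j))"
    using prob_Ball[of "{2..n}" "\<lambda>_. {r 1..}"] unfolding un by (auto simp: A_def)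
  also have "\<dots> = \<P>(\<omega> in M. \<forall>j\<in>{1..n}. v j \<omega> \<in> A j)"
    by (rule prob_Ball[symmetric]) (auto simp: A_def)
  also have "\<dots> \<le> \<P>(\<omega> in M. \<forall>j\<in>{1..<i}. l i < v j \<omega>)"
  proof (rule finite_measure_mono)
    show "{\<omega> \<in> space M. \<forall>j\<in>{1..<i}. l i < v j \<omega>} \<in> events" by (rule mandatory_event[OF i])
    have lr: "l i < r 1" using i one_mem by (intro l_less_r) auto
    have "l i < v j \<omega>" if "v j \<omega> \<in> A j" for j \<omega>
      using that lr by (auto simp: A_def split: if_splits)
    then show "{\<omega> \<in> space M. \<forall>j\<in>{1..n}. v j \<omega> \<in> A j} \<subseteq> {\<omega> \<in> space M. \<forall>j\<in>{1..<i}. l i < v j \<omega>}"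
      using i by auto
  qed
  finally show ?thesis .
qed

lemma cheaper_le_expected_cost:
  assumes "solves_minimum M v n \<sigma>"
  shows "min (A_1 M v n l w) (expected_cost M v w (strategy_ii n r)) \<le> 3 / 2 * expected_cost M v w \<sigma>"
proof -
  from assms have adm: "admissible \<sigma> {1..n}" and meas: "measurable_strategy n \<sigma>"
    by (auto simp: solves_minimum_def)
  define q where "q i = \<P>(\<omega> in M. i \<in> queried \<sigma> (V \<omega>))" for i
  define b where "b = \<P>(\<omega> in M. 1 \<notin> queried \<sigma> (V \<omega>))"
  define a where "a i = \<P>(\<omega> in M. \<forall>j\<in>{1..<i}. l i < v j \<omega>)" for i
  define s where "s i = 1 - \<P>(\<omega> in M. l i < v 1 \<omega>)" for i
  define S where "S = (\<Sum>i=2..n. w i * s i)"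
  \<comment> \<open>Since \<open>p * (1 - s i)\<close> is the probability that \<open>i\<close> is
    mandatory and (ii) skips interval 1, \<open>m\<close> is the expected cost of the mandatory
    intervals when some \<open>v j\<close> with \<open>j \<ge> 2\<close> is below
    \<open>r 1\<close>.\<close>
  define m where "m = (\<Sum>i=2..n. w i * (a i - p * (1 - s i)))"
  have w: "0 < w 1" "\<And>i. i \<in> {2..n} \<Longrightarrow> 0 < w i" using w_pos two_le by auto
  have W: "0 < W" using w two_le by (intro sum_pos) auto
  have "b \<le> p"
    unfolding b_def
  proof (rule finite_measure_mono_AE[OF _ p_event])
    show "AE \<omega> in M. \<omega> \<in> {\<omega> \<in> space M. 1 \<notin> queried \<sigma> (V \<omega>)} \<longrightarrow>
        \<omega> \<in> {\<omega> \<in> space M. \<forall>i\<in>{2..n}. r 1 \<le> v i \<omega>}"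
      using unqueried_1[OF assms] by eventually_elim auto
  qed
  have "q 1 = 1 - b"
    unfolding q_def b_def using pred_queried[OF adm meas, of 1] by (subst prob_neg) (auto simp: pred_def)
  have EC: "expected_cost M v w \<sigma> = w 1 * (1 - b) + (\<Sum>i=2..n. w i * q i)"
    unfolding expected_cost_eq[OF adm meas] sum_split_1 q_def[symmetric] \<open>q 1 = 1 - b\<close> ..
  have "a i + b * s i \<le> q i" if "i \<in> {2..n}" for i
    using prob_queried_ge[OF assms that] by (simp add: a_def b_def s_def q_def)
  then have "(\<Sum>i=2..n. w i * (a i + b * s i)) \<le> (\<Sum>i=2..n. w i * q i)"
    using w by (intro sum_mono mult_left_mono) (auto intro: less_imp_le)
  moreover have "(\<Sum>i=2..n. w i * (a i + b * s i)) = (\<Sum>i=2..n. w i * a i) + b * S"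
    by (simp add: S_def sum_distrib_left sum.distrib algebra_simps)
  moreover have A1: "A_1 M v n l w = w 1 + (\<Sum>i=2..n. w i * a i)"
    unfolding A_1_eq a_def ..
  \<comment> \<open>Skipping interval 1 saves \<open>b * w 1\<close> but pays at least
    \<open>b * S\<close> for intervals that (i) leaves out.\<close>
  ultimately have lower: "A_1 M v n l w - b * (w 1 - S) \<le> expected_cost M v w \<sigma>"
    unfolding EC by (simp add: algebra_simps)
  have "0 \<le> m"
    unfolding m_def using w prob_mandatory_ge
    by (intro sum_nonneg mult_nonneg_nonneg) (auto simp: a_def s_def intro: less_imp_le)
  have "m = (\<Sum>i=2..n. w i * a i) - p * (W - S)"
  proof -
    have "m = (\<Sum>i=2..n. w i * a i - (p * w i - p * (w i * s i)))"
      unfolding m_def by (intro sum.cong refl) (simp add: algebra_simps)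
    also have "\<dots> = (\<Sum>i=2..n. w i * a i) - (p * W - p * S)"
      unfolding S_def sum_subtractf sum_distrib_left[symmetric] ..
    finally show ?thesis by (simp only: right_diff_distrib)
  qed
  then have A1': "A_1 M v n l w = w 1 + m + p * (W - S)" using A1 by simp
  show ?thesis
  proof (cases "w 1 \<le> S")
    \<comment> \<open>Skipping interval 1 does not pay here, so (i) is already at least as cheap as
      \<open>\<sigma>\<close>.\<close>
    case True
    have "0 \<le> b * (S - w 1)" using True by (simp add: b_def)
    then have "A_1 M v n l w \<le> expected_cost M v w \<sigma>" using lower by (simp add: algebra_simps)
    moreover have "0 \<le> expected_cost M v w \<sigma>"
      unfolding expected_cost_eq[OF adm meas] using w_pos
      by (intro sum_nonneg mult_nonneg_nonneg) (auto intro: less_imp_le)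
    ultimately show ?thesis by simp
  next
    case False
    \<comment> \<open>The lower bound decreases in \<open>b\<close>, so its worst case is
      \<open>b = p\<close>, and \<open>S\<close> cancels there.\<close>
    have "b * (w 1 - S) \<le> p * (w 1 - S)" using False \<open>b \<le> p\<close> by (intro mult_right_mono) auto
    then have "(1 - p) * w 1 + p * W + m \<le> expected_cost M v w \<sigma>"
      using lower A1' by (simp add: algebra_simps)
    moreover have "0 \<le> S" unfolding S_def s_def using w
      by (intro sum_nonneg mult_nonneg_nonneg) (auto intro: less_imp_le)
    then have "0 \<le> p * S" by simp
    then have "A_1 M v n l w \<le> (1 - p) * w 1 + p * W + m + p * w 1"
      unfolding A1' by (simp add: algebra_simps)
    moreover have "expected_cost M v w (strategy_ii n r) = (1 - p) * w 1 + p * W + (1 - p) * W"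
      unfolding expected_cost_strategy_ii by (simp add: algebra_simps)
    moreover have "min (p * w 1) ((1 - p) * W) \<le> ((1 - p) * w 1 + p * W) / 2"
      using w W by (intro three_halves_bound) auto
    ultimately show ?thesis using \<open>0 \<le> m\<close> by (auto simp: min_def split: if_splits)
  qed
qed

text \<open>The bound is uniform over all correct strategies and so passes to the infimum, attained
  or not.\<close>

lemma expected_cost_cheaper_strategy:
  "expected_cost M v w (cheaper_strategy n l r (A_1 M v n l w) (expected_cost M v w (strategy_ii n r)))
    \<le> 3 / 2 * opt_cost M v n w"
proof -
  let ?m = "min (A_1 M v n l w) (expected_cost M v w (strategy_ii n r))"
  have "2 / 3 * ?m \<le> opt_cost M v n w"
    unfolding opt_cost_def
  proof (rule cINF_greatest)
    show "{\<sigma>. solves_minimum M v n \<sigma>} \<noteq> {}" using solves_strategy_i by auto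
    show "2 / 3 * ?m \<le> expected_cost M v w \<sigma>" if "\<sigma> \<in> {\<sigma>. solves_minimum M v n \<sigma>}" for \<sigma>
      using cheaper_le_expected_cost[of \<sigma>] that by simp
  qed
  then show ?thesis
    by (auto simp: cheaper_strategy_def expected_cost_strategy_i min_def split: if_splits)
qed

end

text \<open>An atom at \<open>r 1\<close> can make \<open>A_R\<close> exceed the expected cost of
  (ii), so the bound is stated with that cost itself and, in the absence of such atoms, with
  \<open>A_R\<close>.\<close>

theorem theorem3:
  fixes M :: "'a measure" and v :: "nat \<Rightarrow> 'a \<Rightarrow> real"
    and n :: nat and l r w :: "nat \<Rightarrow> real"
  assumes "n \<ge> 2"
    and "\<And>i. i \<in> {1..n} \<Longrightarrow> w i > 0"
    and "prob_space M"
    and "prob_space.indep_vars M (\<lambda>_. borel) v {1..n}"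
    and "\<And>i. i \<in> {1..n} \<Longrightarrow> AE \<omega> in M. v i \<omega> \<in> {l i<..<r i}"
    and "\<And>i \<epsilon>. i \<in> {1..n} \<Longrightarrow> \<epsilon> > 0 \<Longrightarrow> \<P>(\<omega> in M. v i \<omega> < l i + \<epsilon>) > 0"
    and "\<And>i \<epsilon>. i \<in> {1..n} \<Longrightarrow> \<epsilon> > 0 \<Longrightarrow> \<P>(\<omega> in M. v i \<omega> > r i - \<epsilon>) > 0"
    and "mono_on {1..n} l"
    and "\<And>i j. i \<in> {1..n} \<Longrightarrow> j \<in> {1..n} \<Longrightarrow> {l i<..<r i} \<inter> {l j<..<r j} \<noteq> {}"
    and "\<And>j. j \<in> {2..n} \<Longrightarrow> \<not> {l j<..<r j} \<subseteq> {l 1<..<r 1}"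
  shows "solves_minimum M v n (strategy_i n l) \<and> solves_minimum M v n (strategy_ii n r) \<and>
    expected_cost M v w (strategy_i n l) = A_1 M v n l w \<and>
    expected_cost M v w (cheaper_strategy n l r (A_1 M v n l w)
        (expected_cost M v w (strategy_ii n r))) \<le> 3 / 2 * opt_cost M v n w \<and>
    ((\<forall>i\<in>{2..n}. \<P>(\<omega> in M. v i \<omega> = r 1) = 0) \<longrightarrow>
      expected_cost M v w (strategy_ii n r) = A_R M v n r w \<and>
      expected_cost M v w (cheaper_strategy n l r (A_1 M v n l w) (A_R M v n r w))
        \<le> 3 / 2 * opt_cost M v n w)"
proof -
  have lr: "l i < r j" if "i \<in> {1..n}" "j \<in> {1..n}" for i j
    using assms(9)[OF that] by auto
  have r1: "r 1 < r j" if "j \<in> {2..n}" for j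
  proof (rule ccontr)
    assume "\<not> r 1 < r j"
    moreover have "l 1 \<le> l j" using assms(8) that by (auto simp: mono_on_def)
    ultimately have "{l j<..<r j} \<subseteq> {l 1<..<r 1}" by auto
    then show False using assms(10)[OF that] by simp
  qed
  interpret prob_space M by (rule assms(3))
  interpret stochastic_minimum M v n l r w
    by unfold_locales (use assms(1,2,4-8) lr r1 in auto)
  show ?thesis
    using solves_strategy_i solves_strategy_ii expected_cost_strategy_i
      expected_cost_cheaper_strategy expected_cost_strategy_ii_eq_A_R
    by auto
qed

end
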